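(* Let $\Sigma$ be a finite alphabet, $m$ a positive integer and $C_m=\{w\in\Sigma^*\mid |w|=m\}$. For every $\epsilon>0$ there exists a one-way quantum finite automaton with restart $\mathcal{M}_{m,\epsilon}$ with exactly 7 states which accepts every $w\in C_m$ with probability 1 and rejects every $w\in\Sigma^*\setminus C_m$ with probability at least $1-\epsilon$. Moreover, the expected runtime of $\mathcal{M}_{m,\epsilon}$ on input $w$ is $O\big(\frac{1}{\epsilon}2^m|w|\big)$.
   Context: Let $\vdash,\dashv\notin\Sigma$ be left and right end-markers and $\Gamma=\Sigma\cup\{\vdash,\dashv\}$. A one-way quantum finite automaton with restart over $\Sigma$ consists of a finite state set $Q$ partitioned into disjoint sets $Q_{non}$ (nonhalting), $Q_{acc}$ (accepting), $Q_{rej}$ (rejecting), $Q_{restart}$ (restarting), an initial state $q_0\in Q_{non}$, and for each $\sigma\in\Gamma$ a unitary operator $U_\sigma$ on the Hilbert space with orthonormal basis $\{|q\rangle:q\in Q\}$. On input $w$ the tape contains $\vdash w\dashv$. A round starts in $|q_0\rangle$ with the head on $\vdash$; symbols are read left to right; on each symbol $\sigma$ the machine applies $U_\sigma$ and then performs the projective measurement onto the spans of $Q_{acc},Q_{rej},Q_{non},Q_{restart}$: "accept"/"reject" halt with that answer, "nonhalting" continues with the normalized projection onto the span of $Q_{non}$ on the next symbol, "restart" begins a new round from $|q_0\rangle$ with head on $\vdash$. Each round ends in halting or restarting with probability 1. Acceptance/rejection probabilities are those of eventually accepting/rejecting over all rounds; runtime counts all steps of all rounds; the number of states is $|Q|$.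 *)

theory Defs
  imports "HOL-Analysis.Analysis" "HOL-Probability.Probability_Mass_Function"
begin

datatype 'a tape_symbol = Left_End | Right_End | Letter 'a

definition tape :: "'a list \<Rightarrow> 'a tape_symbol list" where
  "tape w = Left_End # map Letter w @ [Right_End]"

definition tape_alphabet :: "'a set \<Rightarrow> 'a tape_symbol set" where
  "tape_alphabet \<Sigma> = {Left_End, Right_End} \<union> Letter ` \<Sigma>"

definition unitary :: "complex^'n^'n \<Rightarrow> bool" where
  "unitary U \<longleftrightarrow>
     (let U' = transpose (\<chi> i j. cnj (U $ i $ j)) in U ** U' = mat 1 \<and> U' ** U = mat 1)"

datatype outcome = Nonhalting | Accepting | Rejecting | Restarting

text \<open>
  The state set is the type of column indices \<open>'q\<close>, so the number of states is its cardinality.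
  The partition of the states into four classes (some possibly empty) is given by \<open>kind\<close>.
\<close>

record ('q::finite, 'a) qfa_restart =
  kind :: "'q \<Rightarrow> outcome"
  init :: 'q
  trans :: "'a tape_symbol \<Rightarrow> complex^'q^'q"

definition project :: "('q::finite, 'a) qfa_restart \<Rightarrow> outcome \<Rightarrow> complex^'q \<Rightarrow> complex^'q" where
  "project M k \<psi> = (\<chi> q. if kind M q = k then \<psi> $ q else 0)"

text \<open>
  Outcome distribution of the projective measurement. The weights sum to one, as \<open>embed_pmf\<close>
  requires, exactly for unit vectors (see \<open>pmf_measurement\<close> below); these are the only ones that
  occur in runs of automata with unitary operators.
\<close>

definition measurement :: "('q::finite, 'a) qfa_restart \<Rightarrow> complex^'q \<Rightarrow> outcome pmf" where
  "measurement M \<psi> = embed_pmf (\<lambda>k. (norm (project M k \<psi>))\<^sup>2)"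

text \<open>\<open>Running i \<psi>\<close>: the head is on the tape cell with index \<open>i\<close>, in the quantum state \<open>\<psi>\<close>.\<close>

datatype 'q config = Running nat "complex^'q" | Accepted | Rejected

definition start :: "('q::finite, 'a) qfa_restart \<Rightarrow> 'q config" where
  "start M = Running 0 (axis (init M) 1)"

fun next_config ::
  "('q::finite, 'a) qfa_restart \<Rightarrow> nat \<Rightarrow> complex^'q \<Rightarrow> outcome \<Rightarrow> 'q config" where
  "next_config M i \<psi> Nonhalting =
     (let \<phi> = project M Nonhalting \<psi> in Running (Suc i) ((1 / norm \<phi>) *\<^sub>R \<phi>))"
| "next_config M i \<psi> Accepting = Accepted"
| "next_config M i \<psi> Rejecting = Rejected"
| "next_config M i \<psi> Restarting = start M"

fun step :: "('q::finite, 'a) qfa_restart \<Rightarrow> 'a list \<Rightarrow> 'q config \<Rightarrow> 'q config pmf" where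
  "step M w (Running i \<psi>) =
     (let \<phi> = trans M (tape w ! i) *v \<psi> in map_pmf (next_config M i \<phi>) (measurement M \<phi>))"
| "step M w Accepted = return_pmf Accepted"
| "step M w Rejected = return_pmf Rejected"

text \<open>Distribution of the configuration after \<open>t\<close> steps, counted across all rounds.\<close>

primrec run :: "('q::finite, 'a) qfa_restart \<Rightarrow> 'a list \<Rightarrow> nat \<Rightarrow> 'q config pmf" where
  "run M w 0 = return_pmf (start M)"
| "run M w (Suc t) = bind_pmf (run M w t) (step M w)"

text \<open>
  The last condition says that every round ends within the tape: with probability one, the head
  never moves beyond the right end-marker.
\<close>

definition is_qfa_restart :: "'a set \<Rightarrow> ('q::finite, 'a) qfa_restart \<Rightarrow> bool" where
  "is_qfa_restart \<Sigma> M \<longleftrightarrow>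
     kind M (init M) = Nonhalting \<and>
     (\<forall>\<sigma>\<in>tape_alphabet \<Sigma>. unitary (trans M \<sigma>)) \<and>
     (\<forall>w\<in>lists \<Sigma>. \<forall>t i \<psi>. Running i \<psi> \<in> set_pmf (run M w t) \<longrightarrow> i < length (tape w))"

text \<open>
  Halted configurations are absorbing, so the probabilities below are nondecreasing in \<open>t\<close> and the
  limits are the probabilities of eventually accepting and rejecting.
\<close>

definition accept_prob :: "('q::finite, 'a) qfa_restart \<Rightarrow> 'a list \<Rightarrow> real" where
  "accept_prob M w = lim (\<lambda>t. pmf (run M w t) Accepted)"

definition reject_prob :: "('q::finite, 'a) qfa_restart \<Rightarrow> 'a list \<Rightarrow> real" where
  "reject_prob M w = lim (\<lambda>t. pmf (run M w t) Rejected)"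

text \<open>
  Step number \<open>t + 1\<close> is carried out iff the automaton has not halted after \<open>t\<close> steps; the expected
  number of steps is the sum of the probabilities of these events, possibly infinite.
\<close>

definition expected_runtime :: "('q::finite, 'a) qfa_restart \<Rightarrow> 'a list \<Rightarrow> ennreal" where
  "expected_runtime M w =
     (\<Sum>t. emeasure (measure_pmf (run M w t)) {c. c \<noteq> Accepted \<and> c \<noteq> Rejected})"

definition words_of_length :: "'a set \<Rightarrow> nat \<Rightarrow> 'a list set" where
  "words_of_length \<Sigma> m = {w \<in> lists \<Sigma>. length w = m}"

lemma UNIV_outcome: "UNIV = {Nonhalting, Accepting, Rejecting, Restarting}"
  using outcome.exhaust by blast

lemma pmf_measurement:
  assumes "norm \<psi> = 1"
  shows "pmf (measurement M \<psi>) k = (norm (project M k \<psi>))\<^sup>2"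
proof -
  have eq: "(norm (project M k \<psi>))\<^sup>2 = (\<Sum>q\<in>UNIV. if kind M q = k then (norm (\<psi> $ q))\<^sup>2 else 0)"
    for k
    unfolding norm_vec_def L2_set_def project_def
    by (subst real_sqrt_pow2) (auto intro!: sum_nonneg sum.cong)
  have fin: "finite (UNIV :: outcome set)"
    by (simp add: UNIV_outcome)
  have "(\<Sum>k\<in>UNIV. (norm (project M k \<psi>))\<^sup>2) =
      (\<Sum>q\<in>UNIV. \<Sum>k\<in>UNIV. if kind M q = k then (norm (\<psi> $ q))\<^sup>2 else 0)"
    unfolding eq by (rule sum.swap)
  also have "\<dots> = (\<Sum>q\<in>UNIV. (norm (\<psi> $ q))\<^sup>2)"
    by (simp add: fin)
  also have "\<dots> = (norm \<psi>)\<^sup>2"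
    unfolding norm_vec_def L2_set_def by (subst real_sqrt_pow2) (auto intro!: sum_nonneg)
  finally have "(\<Sum>k\<in>UNIV. (norm (project M k \<psi>))\<^sup>2) = 1"
    using assms by simp
  then have "(\<integral>\<^sup>+k. ennreal ((norm (project M k \<psi>))\<^sup>2) \<partial>count_space UNIV) = 1"
    by (simp add: nn_integral_count_space_finite fin sum_ennreal)
  then show ?thesis
    unfolding measurement_def by (intro pmf_embed_pmf) auto
qed

end

theory Submission
  imports Defs
begin

text \<open>
  Every round is the same deterministic path of unnormalized quantum states, which loses weight to
  acceptance, rejection and restart. If a round accepts with probability \<open>a\<close> and rejects with
  probability \<open>r\<close>, the automaton eventually accepts with probability \<open>a / (a + r)\<close>, rejects with
  probability \<open>r / (a + r)\<close>, and takes at most (tape length) \<open>/ (a + r)\<close> steps on average.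

  After \<open>\<turnstile>\<close> the automaton is in a state proportional to \<open>(1, x\<^sup>m, \<eta> x\<^sup>m)\<close> with \<open>x = 1 / \<surd>2\<close>. Each letter
  multiplies the first amplitude by \<open>x\<close>, sending the lost part to restart. On the right end-marker the
  difference of the first two amplitudes goes to rejection (their sum to restart) and the third one
  to acceptance. So \<open>r\<close> is proportional to \<open>(x\<^sup>n - x\<^sup>m)\<^sup>2 / 2\<close> for a word of length \<open>n\<close>: it vanishes for
  \<open>n = m\<close> and is at least a constant times \<open>2\<^sup>-\<^sup>m\<close> otherwise, while \<open>a\<close> is proportional to \<open>\<eta>\<^sup>2 2\<^sup>-\<^sup>m\<close>,
  where \<open>\<eta>\<^sup>2\<close> is a small multiple of \<open>min 1 \<epsilon>\<close>.
\<close>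

section \<open>Unitary matrices\<close>

text \<open>The inner product used here is the real part of the Hermitian one, so the conjugate
  transpose is still the adjoint; both sides expand to one double sum.\<close>

lemma inner_adjoint_complex:
  fixes U :: "complex^'n^'m"
  shows "(U *v x) \<bullet> y = x \<bullet> (transpose (\<chi> i j. cnj (U $ i $ j)) *v y)"
proof -
  have "(U *v x) \<bullet> y = (\<Sum>i\<in>UNIV. \<Sum>j\<in>UNIV. Re (U $ i $ j * x $ j * cnj (y $ i)))"
    by (simp add: inner_vec_def matrix_vector_mult_def inner_complex_def sum_distrib_right
        flip: sum.distrib sum_subtractf)
  also have "\<dots> = (\<Sum>j\<in>UNIV. \<Sum>i\<in>UNIV. Re (U $ i $ j * x $ j * cnj (y $ i)))"
    by (rule sum.swap)
  also have "\<dots> = x \<bullet> (transpose (\<chi> i j. cnj (U $ i $ j)) *v y)"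
    by (simp add: inner_vec_def matrix_vector_mult_def inner_complex_def sum_distrib_left transpose_def
        sum.distrib sum_subtractf algebra_simps)
  finally show ?thesis .
qed

lemma norm_unitary:
  assumes "unitary U"
  shows "norm (U *v x) = norm x"
proof -
  have "(U *v x) \<bullet> (U *v x) = x \<bullet> x"
    using assms by (simp add: inner_adjoint_complex unitary_def Let_def matrix_vector_mul_assoc)
  then show ?thesis
    by (simp add: norm_eq_sqrt_inner)
qed

lemma project_scaleR: "project M k (c *\<^sub>R \<psi>) = c *\<^sub>R project M k \<psi>"
  by (simp add: project_def vec_eq_iff)

lemma project_0 [simp]: "project M k 0 = 0"
  by (simp add: project_def vec_eq_iff)

lemma matrix_vector_mult_scaleR_complex: "(U :: complex^'n^'m) *v (c *\<^sub>R x) = c *\<^sub>R (U *v x)"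
  by (simp add: vec_eq_iff matrix_vector_mult_def scaleR_right.sum)

lemma finite_UNIV_outcome [simp]: "finite (UNIV :: outcome set)"
  by (simp add: UNIV_outcome)

text \<open>Scaling to a unit vector turns the summands into measurement probabilities, which add up
  to 1. Arbitrary norms matter because round states are not normalized.\<close>

lemma sum_norm_project:
  "(norm \<psi>)\<^sup>2 = (\<Sum>k\<in>UNIV. (norm (project M k \<psi>))\<^sup>2)"
proof (cases "\<psi> = 0")
  case True
  then show ?thesis by simp
next
  case False
  let ?\<phi> = "(1 / norm \<psi>) *\<^sub>R \<psi>"
  have "(\<Sum>k\<in>UNIV. (norm (project M k ?\<phi>))\<^sup>2) = (\<Sum>k\<in>UNIV. pmf (measurement M ?\<phi>) k)"
    using False by (simp add: pmf_measurement)
  also have "\<dots> = 1"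
    by (intro sum_pmf_eq_1) auto
  finally show ?thesis
    using False by (simp add: project_scaleR power_divide flip: sum_divide_distrib)
qed

section \<open>Rounds\<close>

text \<open>
  States are not renormalized along a round, so that their squared norms are the probabilities of
  reaching the corresponding tape cells within the round.
\<close>

primrec round_state :: "('q::finite, 'a) qfa_restart \<Rightarrow> 'a list \<Rightarrow> nat \<Rightarrow> complex^'q" where
  "round_state M w 0 = axis (init M) 1"
| "round_state M w (Suc i) = project M Nonhalting (trans M (tape w ! i) *v round_state M w i)"

definition outcome_weight ::
  "('q::finite, 'a) qfa_restart \<Rightarrow> 'a list \<Rightarrow> outcome \<Rightarrow> nat \<Rightarrow> real" where
  "outcome_weight M w k i = (norm (project M k (trans M (tape w ! i) *v round_state M w i)))\<^sup>2"

text \<open>For a halting or restarting outcome \<open>k\<close>, the value at \<open>i = 0\<close>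
  is the probability that a whole round ends with \<open>k\<close>.\<close>

definition outcome_tail ::
  "('q::finite, 'a) qfa_restart \<Rightarrow> 'a list \<Rightarrow> outcome \<Rightarrow> nat \<Rightarrow> real" where
  "outcome_tail M w k i = (\<Sum>j = i..<length (tape w). outcome_weight M w k j)"

text \<open>A zero state past the last cell says that this position is reached with probability
  0.\<close>

locale terminating_rounds =
  fixes M :: "('q::finite, 'a) qfa_restart" and w :: "'a list"
  assumes unitary_trans: "\<And>i. i < length (tape w) \<Longrightarrow> unitary (trans M (tape w ! i))"
    and round_ends: "round_state M w (length (tape w)) = 0"
begin

abbreviation "L \<equiv> length (tape w)"
abbreviation "rs \<equiv> round_state M w"
abbreviation "wt \<equiv> outcome_weight M w"
abbreviation "tl_wt \<equiv> outcome_tail M w"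

lemma round_state_beyond: "L \<le> i \<Longrightarrow> rs i = 0"
proof (induction i rule: dec_induct)
  case base
  show ?case by (rule round_ends)
next
  case (step n)
  then show ?case by simp
qed

lemma outcome_weight_nonneg: "0 \<le> wt k i"
  by (simp add: outcome_weight_def)

lemma outcome_tail_nonneg: "0 \<le> tl_wt k i"
  by (simp add: outcome_tail_def outcome_weight_nonneg sum_nonneg)

lemma outcome_tail_step: "i < L \<Longrightarrow> tl_wt k i = wt k i + tl_wt k (Suc i)"
  by (simp add: outcome_tail_def sum.atLeast_Suc_lessThan)

text \<open>Unitarity preserves the norm and the measurement splits it orthogonally; the nonhalting
  part is the next round state.\<close>

lemma norm_round_state_step:
  assumes "i < L"
  shows "(norm (rs i))\<^sup>2
    = (norm (rs (Suc i)))\<^sup>2 + wt Accepting i + wt Rejecting i + wt Restarting i"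
proof -
  have "(norm (rs i))\<^sup>2 = (norm (trans M (tape w ! i) *v rs i))\<^sup>2"
    using assms by (simp add: norm_unitary unitary_trans)
  also have "\<dots> = (\<Sum>k\<in>UNIV. wt k i)"
    by (subst sum_norm_project[of _ M]) (simp add: outcome_weight_def)
  finally show ?thesis
    by (simp add: UNIV_outcome outcome_weight_def)
qed

text \<open>Telescoping backwards from the end of the tape, where the state is zero: all weight
  reaching a cell leaves the round there or later.\<close>

lemma norm_round_state_eq_tails:
  "(norm (rs i))\<^sup>2 = tl_wt Accepting i + tl_wt Rejecting i + tl_wt Restarting i"
proof (cases "i \<le> L")
  case True
  then show ?thesis
  proof (induction i rule: inc_induct)
    case base
    show ?case by (simp add: round_ends outcome_tail_def)
  next
    case (step n)
    then show ?case by (simp add: norm_round_state_step outcome_tail_step del: round_state.simps)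
  qed
next
  case False
  then show ?thesis by (simp add: round_state_beyond outcome_tail_def)
qed

section \<open>Configurations reachable in a run\<close>

definition round_config :: "nat \<Rightarrow> 'q config" where
  "round_config i = Running i ((1 / norm (rs i)) *\<^sub>R rs i)"

text \<open>Rounds follow one deterministic path of states, so this finite set contains every
  reachable configuration and all expectations become finite sums.\<close>

definition configs :: "'q config set" where
  "configs = {Accepted, Rejected} \<union> round_config ` {i. i < L \<and> rs i \<noteq> 0}"

lemma finite_configs: "finite configs"
  by (simp add: configs_def)

lemma start_eq_round_config: "start M = round_config 0"
  by (simp add: start_def round_config_def)

lemma round_state_0_nonzero: "rs 0 \<noteq> 0"
  by (simp add: axis_eq_0_iff)

lemma length_tape_pos: "0 < L"
  by (simp add: tape_def)

lemma start_in_configs: "start M \<in> configs"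
  using length_tape_pos round_state_0_nonzero
  by (auto simp: configs_def start_eq_round_config simp del: round_state.simps)

lemma step_round_config:
  assumes "i < L" "rs i \<noteq> 0"
  defines "\<phi> \<equiv> trans M (tape w ! i) *v ((1 / norm (rs i)) *\<^sub>R rs i)"
  shows "step M w (round_config i) = map_pmf (next_config M i \<phi>) (measurement M \<phi>)"
    and "pmf (measurement M \<phi>) k = wt k i / (norm (rs i))\<^sup>2"
    and "next_config M i \<phi> Nonhalting = round_config (Suc i)"
proof -
  have \<phi>: "\<phi> = (1 / norm (rs i)) *\<^sub>R (trans M (tape w ! i) *v rs i)"
    by (simp add: \<phi>_def matrix_vector_mult_scaleR_complex)
  have "norm \<phi> = 1"
    using assms by (simp add: \<phi> norm_unitary unitary_trans)
  then have "pmf (measurement M \<phi>) k = (norm (project M k \<phi>))\<^sup>2"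
    by (rule pmf_measurement)
  also have "\<dots> = wt k i / (norm (rs i))\<^sup>2"
    by (simp add: \<phi> project_scaleR outcome_weight_def power_divide)
  finally show "pmf (measurement M \<phi>) k = wt k i / (norm (rs i))\<^sup>2" .
  show "step M w (round_config i) = map_pmf (next_config M i \<phi>) (measurement M \<phi>)"
    by (simp add: round_config_def \<phi>_def Let_def)
  \<comment> \<open>The positive factor \<open>1 / norm (rs i)\<close> cancels on renormalization;
    if the nonhalting part is zero, both sides carry the zero vector.\<close>
  show "next_config M i \<phi> Nonhalting = round_config (Suc i)"
    using assms(2) by (simp add: \<phi> project_scaleR round_config_def)
qed

lemma set_step_subset:
  assumes "c \<in> configs"
  shows "set_pmf (step M w c) \<subseteq> configs"
proof (cases "c = Accepted \<or> c = Rejected")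
  case True
  then show ?thesis using assms by auto
next
  case False
  then obtain i where i: "i < L" "rs i \<noteq> 0" "c = round_config i"
    using assms by (auto simp: configs_def)
  note st = step_round_config[OF i(1,2)]
  show ?thesis
  proof
    fix d
    assume d: "d \<in> set_pmf (step M w c)"
    let ?\<phi> = "trans M (tape w ! i) *v ((1 / norm (rs i)) *\<^sub>R rs i)"
    obtain k where k: "k \<in> set_pmf (measurement M ?\<phi>)" "d = next_config M i ?\<phi> k"
      using d unfolding i(3) st(1) by auto
    show "d \<in> configs"
    proof (cases k)
      case Nonhalting
      \<comment> \<open>An outcome of positive probability has nonzero weight, so the next state is
        nonzero and the head is still on the tape.\<close>
      have "wt k i \<noteq> 0"
        using k(1) st(2)[of k] by (auto simp: set_pmf_iff)
      then have nz: "rs (Suc i) \<noteq> 0"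
        by (simp add: Nonhalting outcome_weight_def)
      then have "Suc i < L"
        using round_state_beyond not_less by blast
      then show ?thesis
        using nz k(2) st(3) by (auto simp: Nonhalting configs_def simp del: round_state.simps)
    qed (use k(2) start_in_configs in \<open>auto simp: configs_def\<close>)
  qed
qed

lemma set_run_subset: "set_pmf (run M w t) \<subseteq> configs"
  by (induction t) (use start_in_configs set_step_subset in auto)

lemma running_in_run:
  assumes "Running i \<psi> \<in> set_pmf (run M w t)"
  shows "i < L"
  using set_run_subset[of t] assms by (auto simp: configs_def round_config_def)

text \<open>
  The quantum state of a reachable configuration is determined by its tape position, so it suffices
  to consider functions of the position. They are scaled by the probability of reaching the
  position, which avoids conditional probabilities.
\<close>

fun config_value :: "(nat \<Rightarrow> real) \<Rightarrow> real \<Rightarrow> real \<Rightarrow> 'q config \<Rightarrow> real" where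
  "config_value f a r (Running i \<psi>) = f i / (norm (rs i))\<^sup>2"
| "config_value f a r Accepted = a"
| "config_value f a r Rejected = r"

lemma config_value_round_config: "config_value f a r (round_config i) = f i / (norm (rs i))\<^sup>2"
  by (simp add: round_config_def)

text \<open>The nonhalting outcome contributes just \<open>f (Suc i)\<close>, because its weight
  cancels the denominator at the next cell. The assumption on \<open>f\<close> covers the case of
  zero weight.\<close>

lemma expectation_step:
  assumes "i < L" "rs i \<noteq> 0" and f0: "\<And>i. rs i = 0 \<Longrightarrow> f i = 0"
  shows "measure_pmf.expectation (step M w (round_config i)) (config_value f a r) =
    (f (Suc i) + wt Accepting i * a + wt Rejecting i * r + wt Restarting i * f 0) / (norm (rs i))\<^sup>2"
proof -
  note st = step_round_config[OF assms(1,2)]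
  let ?\<phi> = "trans M (tape w ! i) *v ((1 / norm (rs i)) *\<^sub>R rs i)"
  have "measure_pmf.expectation (step M w (round_config i)) (config_value f a r) =
      (\<Sum>k\<in>UNIV. config_value f a r (next_config M i ?\<phi> k) * pmf (measurement M ?\<phi>) k)"
    unfolding st(1) integral_map_pmf
    by (rule integral_measure_pmf_real) simp_all
  also have "\<dots> = (\<Sum>k\<in>UNIV. config_value f a r (next_config M i ?\<phi> k) * wt k i) / (norm (rs i))\<^sup>2"
    by (simp add: st(2) sum_divide_distrib)
  also have "(\<Sum>k\<in>UNIV. config_value f a r (next_config M i ?\<phi> k) * wt k i) =
      config_value f a r (round_config (Suc i)) * wt Nonhalting i
      + a * wt Accepting i + r * wt Rejecting i + f 0 * wt Restarting i"
    by (simp add: UNIV_outcome st(3) start_eq_round_config config_value_round_config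
        del: next_config.simps(1))
  also have "config_value f a r (round_config (Suc i)) * wt Nonhalting i = f (Suc i)"
    using f0[of "Suc i"] by (auto simp: config_value_round_config outcome_weight_def)
  finally show ?thesis
    by (simp add: algebra_simps)
qed

lemma expectation_run:
  "measure_pmf.expectation (run M w t) h = (\<Sum>c\<in>configs. pmf (run M w t) c * h c)"
  by (subst integral_measure_pmf_real[OF finite_configs]) (use set_run_subset in \<open>auto simp: mult.commute\<close>)

lemma expectation_run_Suc:
  "measure_pmf.expectation (run M w (Suc t)) h =
    (\<Sum>c\<in>configs. pmf (run M w t) c * measure_pmf.expectation (step M w c) h)"
proof -
  have "measure_pmf.expectation (run M w t \<bind> step M w) h =
      (\<Sum>c\<in>configs. pmf (run M w t) c *\<^sub>R measure_pmf.expectation (step M w c) h)"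
    by (intro pmf_expectation_bind finite_configs set_run_subset
        finite_subset[OF set_step_subset finite_configs])
  then show ?thesis
    by simp
qed

section \<open>Running probability and expected runtime\<close>

definition running_prob :: "nat \<Rightarrow> real" where
  "running_prob t = measure_pmf.prob (run M w t) {c. c \<noteq> Accepted \<and> c \<noteq> Rejected}"

lemma running_prob_eq: "running_prob t = (\<Sum>c\<in>configs - {Accepted, Rejected}. pmf (run M w t) c)"
proof -
  have "running_prob t = measure_pmf.prob (run M w t) (configs - {Accepted, Rejected})"
    unfolding running_prob_def
    by (rule measure_pmf.finite_measure_eq_AE) (use set_run_subset in \<open>auto simp: AE_measure_pmf_iff\<close>)
  then show ?thesis
    by (simp add: measure_measure_pmf_finite finite_configs)
qed

lemma sum_configs:
  "(\<Sum>c\<in>configs. g c) = g Accepted + g Rejected + (\<Sum>c\<in>configs - {Accepted, Rejected}. g c)" for g :: "_ \<Rightarrow> real"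
proof -
  have "configs = insert Accepted (insert Rejected (configs - {Accepted, Rejected}))"
    by (auto simp: configs_def)
  then have "sum g configs = sum g (insert Accepted (insert Rejected (configs - {Accepted, Rejected})))"
    by simp
  then show ?thesis
    using finite_configs by simp
qed

lemma sum_pmf_run: "pmf (run M w t) Accepted + pmf (run M w t) Rejected + running_prob t = 1"
  using sum_pmf_eq_1[OF finite_configs set_run_subset]
  by (simp add: running_prob_eq sum_configs)

lemma config_cases:
  assumes "c \<in> configs"
  obtains "c = Accepted" | "c = Rejected" | i where "i < L" "rs i \<noteq> 0" "c = round_config i"
  using assms by (auto simp: configs_def)

definition halt_weight :: real where
  "halt_weight = tl_wt Accepting 0 + tl_wt Rejecting 0"

lemma restart_tail_0: "tl_wt Restarting 0 = 1 - halt_weight"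
  using norm_round_state_eq_tails[of 0] by (simp add: halt_weight_def norm_axis_1)

text \<open>Three nonnegative tails add up to the squared norm. This supplies the vanishing
  condition of \<open>expectation_step\<close>.\<close>

lemma outcome_tail_eq_0:
  assumes "rs i = 0"
  shows "tl_wt Accepting i = 0" "tl_wt Rejecting i = 0" "tl_wt Restarting i = 0"
  using norm_round_state_eq_tails[of i] outcome_tail_nonneg[of Accepting i]
    outcome_tail_nonneg[of Rejecting i] outcome_tail_nonneg[of Restarting i] assms
  by auto

text \<open>
  From cell \<open>i\<close> a round restarts with probability \<open>tl_wt Restarting i / (norm (rs i))\<^sup>2\<close>. Each restart
  costs at most the expected time \<open>D = L / halt_weight\<close>, and the current round at most \<open>L - i\<close> steps;
  the resulting bound on the remaining time drops by at least one in expectation in each step.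
\<close>

definition time_bound :: "nat \<Rightarrow> real" where
  "time_bound i = (norm (rs i))\<^sup>2 * (real L - real i) + real L / halt_weight * tl_wt Restarting i"

text \<open>Drift argument: the expected potential after \<open>T\<close> steps plus the running
  probabilities so far never exceeds the initial potential, and the potential is
  nonnegative.\<close>

lemma sum_running_prob_le:
  assumes "halt_weight > 0"
  shows "(\<Sum>t<T. running_prob t) \<le> real L / halt_weight"
proof -
  let ?V = "config_value time_bound 0 0"
  let ?D = "real L / halt_weight"
  \<comment> \<open>\<open>D\<close> solves \<open>L + D * (1 - halt_weight) = D\<close>, so a
    restart puts the potential back to exactly \<open>D\<close>.\<close>
  have V0: "time_bound 0 = ?D"
    using assms by (simp add: time_bound_def norm_axis_1 restart_tail_0 field_simps)
  have drop: "measure_pmf.expectation (step M w c) ?V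
      \<le> ?V c - (if c \<in> {Accepted, Rejected} then 0 else 1)" if "c \<in> configs" for c
    using that
  proof (cases rule: config_cases)
    case (3 i)
    let ?N = "\<lambda>j. (norm (rs j))\<^sup>2"
    have N: "?N i > 0"
      using 3 by simp
    have "?N (Suc i) \<le> ?N i"
      using 3 norm_round_state_step[of i] outcome_weight_nonneg[of Accepting i]
        outcome_weight_nonneg[of Rejecting i] outcome_weight_nonneg[of Restarting i]
      by (simp del: round_state.simps)
    \<comment> \<open>Weight leaving the round at cell \<open>i\<close> can only lower the remaining
      cost; the factor is nonnegative because \<open>i < L\<close>.\<close>
    then have "?N (Suc i) * (real L - real i - 1) \<le> ?N i * (real L - real i - 1)"
      using 3 by (intro mult_right_mono) auto
    then have "time_bound (Suc i) + wt Restarting i * time_bound 0 \<le> time_bound i - ?N i"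
      using 3 unfolding V0 by (simp add: time_bound_def outcome_tail_step algebra_simps del: round_state.simps)
    then have "(time_bound (Suc i) + wt Restarting i * time_bound 0) / ?N i \<le> time_bound i / ?N i - 1"
      using N divide_right_mono[of "time_bound (Suc i) + wt Restarting i * time_bound 0"
          "time_bound i - ?N i" "?N i"]
      by (simp add: diff_divide_distrib del: round_state.simps)
    moreover have "time_bound j = 0" if "rs j = 0" for j
      using that by (simp add: time_bound_def outcome_tail_eq_0)
    ultimately show ?thesis
      using 3 by (simp add: expectation_step config_value_round_config)
  qed auto
  have nonneg: "?V c \<ge> 0" if "c \<in> configs" for c
    using that
  proof (cases rule: config_cases)
    case (3 i)
    then show ?thesis
      using assms outcome_tail_nonneg by (simp add: config_value_round_config time_bound_def)
  qed auto
  have "measure_pmf.expectation (run M w T) ?V + (\<Sum>t<T. running_prob t) \<le> ?D"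
  proof (induction T)
    case 0
    show ?case
      using V0 by (simp add: start_eq_round_config config_value_round_config norm_axis_1)
  next
    case (Suc T)
    have "measure_pmf.expectation (run M w (Suc T)) ?V \<le>
        (\<Sum>c\<in>configs. pmf (run M w T) c * (?V c - (if c \<in> {Accepted, Rejected} then 0 else 1)))"
      unfolding expectation_run_Suc by (intro sum_mono mult_left_mono drop) auto
    also have "\<dots> = measure_pmf.expectation (run M w T) ?V
        - (\<Sum>c\<in>configs. pmf (run M w T) c * (if c \<in> {Accepted, Rejected} then 0 else 1))"
      by (simp add: expectation_run right_diff_distrib sum_subtractf)
    also have "(\<Sum>c\<in>configs. pmf (run M w T) c * (if c \<in> {Accepted, Rejected} then 0 else 1))
        = running_prob T"
      unfolding sum_configs running_prob_eq by simp
    finally show ?case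
      using Suc.IH by simp
  qed
  moreover have "measure_pmf.expectation (run M w T) ?V \<ge> 0"
    unfolding expectation_run by (intro sum_nonneg mult_nonneg_nonneg nonneg) auto
  ultimately show ?thesis
    by linarith
qed

lemma summable_running_prob:
  assumes "halt_weight > 0"
  shows "summable running_prob"
  using sum_running_prob_le[OF assms]
  by (intro summableI_nonneg_bounded[where x = "real L / halt_weight"]) (auto simp: running_prob_def)

theorem expected_runtime_le:
  assumes "halt_weight > 0"
  shows "expected_runtime M w \<le> ennreal (real L / halt_weight)"
proof -
  have "expected_runtime M w = (\<Sum>t. ennreal (running_prob t))"
    by (simp add: expected_runtime_def running_prob_def measure_pmf.emeasure_eq_measure)
  also have "\<dots> = ennreal (\<Sum>t. running_prob t)"
    by (rule suminf_ennreal2[OF _ summable_running_prob[OF assms]]) (simp add: running_prob_def)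
  also have "\<dots> \<le> ennreal (real L / halt_weight)"
    by (intro ennreal_leI suminf_le_const summable_running_prob sum_running_prob_le assms)
  finally show ?thesis .
qed

section \<open>Acceptance and rejection probabilities\<close>

text \<open>
  The probability of eventually accepting is a harmonic function of the configuration; its value at
  the start is the share of acceptance in the halting weight of a round.
\<close>

lemma accepted_bounds:
  assumes "halt_weight > 0"
  defines "g \<equiv> tl_wt Accepting 0 / halt_weight"
  shows "pmf (run M w t) Accepted \<le> g" "g \<le> pmf (run M w t) Accepted + running_prob t"
proof -
  \<comment> \<open>Scaled by the probability of reaching cell \<open>i\<close>: accept within this
    round, or restart and accept later with probability \<open>g\<close>.\<close>
  define f where "f i = tl_wt Accepting i + tl_wt Restarting i * g" for i
  let ?G = "config_value f 1 0"
  have g: "0 \<le> g" "g \<le> 1"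
    using assms outcome_tail_nonneg[of _ 0] by (auto simp: g_def halt_weight_def)
  have f0: "f 0 = g"
    using assms(1) by (simp add: f_def g_def restart_tail_0 field_simps)
  have harmonic: "measure_pmf.expectation (step M w c) ?G = ?G c" if "c \<in> configs" for c
    using that
  proof (cases rule: config_cases)
    case (3 i)
    moreover have "f j = 0" if "rs j = 0" for j
      using that by (simp add: f_def outcome_tail_eq_0)
    moreover have "f (Suc i) + wt Accepting i + wt Restarting i * g = f i"
      using 3 by (simp add: f_def outcome_tail_step algebra_simps)
    ultimately show ?thesis
      by (simp add: expectation_step config_value_round_config f0)
  qed auto
  have "measure_pmf.expectation (run M w t) ?G = g"
  proof (induction t)
    case 0
    show ?case
      by (simp add: start_eq_round_config config_value_round_config norm_axis_1 f0)
  next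
    case (Suc t)
    then show ?case
      unfolding expectation_run_Suc by (simp add: harmonic expectation_run)
  qed
  \<comment> \<open>The constant expectation splits into the accepted part, of value 1, and the
    running part. Values in \<open>[0, 1]\<close> then place the running part between 0 and
    \<open>running_prob t\<close>.\<close>
  then have *: "g = pmf (run M w t) Accepted
      + (\<Sum>c\<in>configs - {Accepted, Rejected}. pmf (run M w t) c * ?G c)"
    by (simp add: expectation_run sum_configs)
  have G: "0 \<le> ?G c \<and> ?G c \<le> 1" if "c \<in> configs" for c
    using that
  proof (cases rule: config_cases)
    case (3 i)
    have "tl_wt Restarting i * g \<le> tl_wt Restarting i"
      using g outcome_tail_nonneg[of Restarting i] by (simp add: mult_left_le)
    then have "f i \<le> (norm (rs i))\<^sup>2"
      using outcome_tail_nonneg[of Rejecting i] by (simp add: norm_round_state_eq_tails f_def)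
    moreover have "0 \<le> f i"
      using g outcome_tail_nonneg[of _ i] by (simp add: f_def)
    ultimately show ?thesis
      using 3 by (simp add: config_value_round_config)
  qed auto
  show "pmf (run M w t) Accepted \<le> g"
    unfolding * using G by (auto intro!: sum_nonneg)
  show "g \<le> pmf (run M w t) Accepted + running_prob t"
    unfolding running_prob_eq by (subst *) (use G in \<open>auto intro!: sum_mono simp: mult_left_le\<close>)
qed

text \<open>The running probabilities are summable and hence tend to 0, so the two bounds squeeze
  the acceptance probability; rejection takes the rest.\<close>

theorem accept_reject_prob:
  assumes "halt_weight > 0"
  shows "accept_prob M w = tl_wt Accepting 0 / halt_weight"
    and "reject_prob M w = tl_wt Rejecting 0 / halt_weight"
proof -
  let ?g = "tl_wt Accepting 0 / halt_weight"
  have run0: "running_prob \<longlonglongrightarrow> 0"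
    by (rule summable_LIMSEQ_zero[OF summable_running_prob[OF assms]])
  have "(\<lambda>t. ?g - running_prob t) \<longlonglongrightarrow> ?g"
    using tendsto_diff[OF tendsto_const run0, of ?g] by simp
  then have acc: "(\<lambda>t. pmf (run M w t) Accepted) \<longlonglongrightarrow> ?g"
    by (rule tendsto_sandwich[rotated 2, OF _ tendsto_const])
      (use accepted_bounds[OF assms] in \<open>auto simp: algebra_simps\<close>)
  then show "accept_prob M w = ?g"
    unfolding accept_prob_def by (rule limI)
  have "(\<lambda>t. 1 - pmf (run M w t) Accepted - running_prob t) \<longlonglongrightarrow> 1 - ?g - 0"
    by (intro tendsto_intros acc run0)
  moreover have "(\<lambda>t. 1 - pmf (run M w t) Accepted - running_prob t) = (\<lambda>t. pmf (run M w t) Rejected)"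
    using sum_pmf_run by (auto simp: fun_eq_iff algebra_simps)
  moreover have "1 - ?g - 0 = tl_wt Rejecting 0 / halt_weight"
    using assms by (simp add: halt_weight_def field_simps)
  ultimately show "reject_prob M w = tl_wt Rejecting 0 / halt_weight"
    unfolding reject_prob_def by (metis limI)
qed

end

section \<open>Reflections and real automata\<close>

text \<open>Householder reflection, used to obtain orthogonal maps with prescribed images without
  writing out matrices. For \<open>v = 0\<close> it is the identity.\<close>

definition reflection :: "'a::real_inner \<Rightarrow> 'a \<Rightarrow> 'a" where
  "reflection v x = x - (2 * (v \<bullet> x) / (v \<bullet> v)) *\<^sub>R v"

lemma linear_reflection: "linear (reflection v)"
  by (rule linearI) (simp_all add: reflection_def inner_add_right algebra_simps add_divide_distrib)

lemma orthogonal_transformation_reflection: "orthogonal_transformation (reflection v)"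
proof -
  have "reflection v x \<bullet> reflection v y = x \<bullet> y" for x y
  proof (cases "v = 0")
    case False
    then show ?thesis
      by (simp add: reflection_def inner_diff_left inner_diff_right inner_commute[of x v]
          inner_commute[of y x] field_simps)
  qed (simp add: reflection_def)
  then show ?thesis
    by (simp add: orthogonal_transformation_def linear_reflection)
qed

lemma reflection_orthogonal: "v \<bullet> x = 0 \<Longrightarrow> reflection v x = x"
  by (simp add: reflection_def)

text \<open>For vectors of equal norm, \<open>v = x - y\<close> satisfies
  \<open>v \<bullet> v = 2 * (v \<bullet> x)\<close>, so the reflection subtracts exactly
  \<open>v\<close> from \<open>x\<close>.\<close>

lemma reflection_diff:
  assumes "x \<bullet> x = y \<bullet> y"
  shows "reflection (x - y) x = y"
proof (cases "x = y")
  case False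
  have "(x - y) \<bullet> (x - y) = 2 * ((x - y) \<bullet> x)"
    using assms by (simp add: inner_diff_left inner_diff_right inner_commute[of y x])
  moreover have "(x - y) \<bullet> (x - y) \<noteq> 0"
    using False by simp
  ultimately show ?thesis
    by (simp add: reflection_def)
qed (simp add: reflection_def)

section \<open>Real orthogonal matrices as unitary complex matrices\<close>

definition cmat :: "real^'n^'m \<Rightarrow> complex^'n^'m" where
  "cmat A = (\<chi> i j. complex_of_real (A $ i $ j))"

definition cvec :: "real^'n \<Rightarrow> complex^'n" where
  "cvec r = (\<chi> i. complex_of_real (r $ i))"

lemma cmat_vector_mult: "cmat A *v cvec r = cvec (A *v r)"
  by (simp add: cmat_def cvec_def vec_eq_iff matrix_vector_mult_def)

lemma unitary_cmat:
  assumes "orthogonal_matrix A"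
  shows "unitary (cmat A)"
proof -
  have mult: "cmat B ** cmat C = cmat (B ** C)" for B C :: "real^'a^'a"
    by (simp add: cmat_def vec_eq_iff matrix_matrix_mult_def)
  have "transpose (\<chi> i j. cnj (cmat A $ i $ j)) = cmat (transpose A)"
    by (simp add: cmat_def transpose_def vec_eq_iff)
  moreover have "cmat (mat 1 :: real^'a^'a) = mat 1"
    by (simp add: cmat_def mat_def vec_eq_iff)
  ultimately show ?thesis
    using assms by (simp add: unitary_def mult orthogonal_matrix_def)
qed

lemma norm_cvec: "norm (cvec r) = norm r"
  by (simp add: cvec_def norm_vec_def)

lemma cvec_0: "cvec 0 = 0"
  by (simp add: cvec_def vec_eq_iff)

lemma cvec_axis: "cvec (axis i a) = axis i (complex_of_real a)"
  by (simp add: cvec_def axis_def vec_eq_iff)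

definition restrict_kind :: "('q::finite, 'a) qfa_restart \<Rightarrow> outcome \<Rightarrow> real^'q \<Rightarrow> real^'q" where
  "restrict_kind M k r = (\<chi> q. if kind M q = k then r $ q else 0)"

lemma project_cvec: "project M k (cvec r) = cvec (restrict_kind M k r)"
  by (simp add: project_def restrict_kind_def cvec_def vec_eq_iff)

lemma restrict_kind_simps:
  "restrict_kind M k (r + s) = restrict_kind M k r + restrict_kind M k s"
  "restrict_kind M k (r - s) = restrict_kind M k r - restrict_kind M k s"
  "restrict_kind M k (a *\<^sub>R r) = a *\<^sub>R restrict_kind M k r"
  "restrict_kind M k (axis q b) = (if kind M q = k then axis q b else 0)"
  by (auto simp: restrict_kind_def vec_eq_iff axis_def)

section \<open>The automaton\<close>

abbreviation unit7 :: "7 \<Rightarrow> real^7" where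
  "unit7 i \<equiv> axis i 1"

text \<open>State 0 will count letters, state 1 holds the reference amplitude \<open>b\<close>,
  later \<open>half_root ^ m\<close>, and state 2 the amplitude \<open>d\<close> reserved for
  acceptance.\<close>

definition initial_vector :: "real \<Rightarrow> real \<Rightarrow> real^7" where
  "initial_vector b d = unit7 0 + b *\<^sub>R unit7 1 + d *\<^sub>R unit7 2"

definition half_root :: real where
  "half_root = sqrt (1 / 2)"

text \<open>Only the images of the reachable basis states matter, and each reflection moves one of
  them to its intended image. The three mirror vectors at the right end-marker are pairwise
  orthogonal, so these reflections do not disturb each other.\<close>

fun real_trans :: "real \<Rightarrow> real \<Rightarrow> 'a tape_symbol \<Rightarrow> real^7 \<Rightarrow> real^7" where
  "real_trans b d Left_End = reflection (unit7 0 - sgn (initial_vector b d))"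
| "real_trans b d (Letter a) = reflection (unit7 0 - half_root *\<^sub>R (unit7 0 + unit7 5))"
| "real_trans b d Right_End = reflection (unit7 0 - half_root *\<^sub>R (unit7 5 + unit7 4))
     \<circ> reflection (unit7 1 - half_root *\<^sub>R (unit7 5 - unit7 4)) \<circ> reflection (unit7 2 - unit7 3)"

text \<open>State 6 is never entered; it only pads the automaton to seven states.\<close>

definition length_qfa :: "real \<Rightarrow> real \<Rightarrow> (7, 'a) qfa_restart" where
  "length_qfa b d =
    \<lparr>kind = (\<lambda>q. if q = 3 then Accepting else if q = 4 then Rejecting
       else if q = 5 \<or> q = 6 then Restarting else Nonhalting),
     init = 0,
     trans = (\<lambda>s. cmat (matrix (real_trans b d s)))\<rparr>"

lemma half_root_sq: "half_root * half_root = 1 / 2" "half_root * (2 * half_root) = 1" "half_root\<^sup>2 = 1 / 2"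
proof -
  show "half_root * half_root = 1 / 2" "half_root\<^sup>2 = 1 / 2"
    by (simp_all add: half_root_def)
  then show "half_root * (2 * half_root) = 1"
    by simp
qed

lemma orthogonal_transformation_real_trans: "orthogonal_transformation (real_trans b d s)"
  by (cases s) (auto intro!: orthogonal_transformation_compose orthogonal_transformation_reflection)

lemma unitary_length_qfa: "unitary (trans (length_qfa b d) s)"
  using orthogonal_transformation_real_trans[of b d s]
  by (simp add: length_qfa_def unitary_cmat orthogonal_transformation_matrix)

lemma linear_real_trans: "linear (real_trans b d s)"
  by (rule orthogonal_transformation_linear[OF orthogonal_transformation_real_trans])

lemma trans_length_qfa: "trans (length_qfa b d) s *v cvec r = cvec (real_trans b d s r)"
  by (simp add: length_qfa_def cmat_vector_mult matrix_works linear_real_trans)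

lemma initial_vector_nonzero: "initial_vector b d \<noteq> 0"
proof
  assume "initial_vector b d = 0"
  then have "initial_vector b d $ 0 = 0" by simp
  then show False by (simp add: initial_vector_def axis_def)
qed

lemma real_trans_Left_End:
  "real_trans b d Left_End (unit7 0) = sgn (initial_vector b d)"
  unfolding real_trans.simps using initial_vector_nonzero[of b d]
  by (intro reflection_diff) (simp add: norm_eq_1 flip: power2_norm_eq_inner add: norm_sgn norm_axis_1)

lemma real_trans_Letter:
  "real_trans b d (Letter a) (unit7 0) = half_root *\<^sub>R (unit7 0 + unit7 5)"
  "real_trans b d (Letter a) (unit7 1) = unit7 1"
  "real_trans b d (Letter a) (unit7 2) = unit7 2"
  unfolding real_trans.simps
  by (intro reflection_diff reflection_orthogonal;
      simp add: inner_add_left inner_add_right inner_diff_left inner_axis_axis half_root_sq)+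

lemma real_trans_Right_End:
  "real_trans b d Right_End (unit7 0) = half_root *\<^sub>R (unit7 5 + unit7 4)"
  "real_trans b d Right_End (unit7 1) = half_root *\<^sub>R (unit7 5 - unit7 4)"
  "real_trans b d Right_End (unit7 2) = unit7 3"
proof -
  let ?r0 = "reflection (unit7 0 - half_root *\<^sub>R (unit7 5 + unit7 4))"
  let ?r1 = "reflection (unit7 1 - half_root *\<^sub>R (unit7 5 - unit7 4))"
  let ?r2 = "reflection (unit7 2 - unit7 3)"
  note inner = inner_add_left inner_add_right inner_diff_left inner_diff_right inner_axis_axis half_root_sq
  \<comment> \<open>Each of the basis vectors 0, 1, 2 is moved by exactly one reflection; those
    applied earlier fix the vector, those applied later fix its image.\<close>
  have "?r2 (unit7 0) = unit7 0" "?r1 (unit7 0) = unit7 0"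
    "?r2 (unit7 1) = unit7 1" "?r1 (unit7 3) = unit7 3" "?r0 (unit7 3) = unit7 3"
    "?r0 (half_root *\<^sub>R (unit7 5 - unit7 4)) = half_root *\<^sub>R (unit7 5 - unit7 4)"
    by (intro reflection_orthogonal; simp add: inner)+
  moreover have "?r0 (unit7 0) = half_root *\<^sub>R (unit7 5 + unit7 4)"
    "?r1 (unit7 1) = half_root *\<^sub>R (unit7 5 - unit7 4)" "?r2 (unit7 2) = unit7 3"
    by (intro reflection_diff; simp add: inner)+
  ultimately show
    "real_trans b d Right_End (unit7 0) = half_root *\<^sub>R (unit7 5 + unit7 4)"
    "real_trans b d Right_End (unit7 1) = half_root *\<^sub>R (unit7 5 - unit7 4)"
    "real_trans b d Right_End (unit7 2) = unit7 3"
    by simp_all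
qed

lemma kind_length_qfa:
  "kind (length_qfa b d) 0 = Nonhalting" "kind (length_qfa b d) 1 = Nonhalting"
  "kind (length_qfa b d) 2 = Nonhalting" "kind (length_qfa b d) 3 = Accepting"
  "kind (length_qfa b d) 4 = Rejecting" "kind (length_qfa b d) 5 = Restarting"
  by (simp_all add: length_qfa_def)

lemma tape_nth:
  "tape w ! 0 = Left_End"
  "i < length w \<Longrightarrow> tape w ! Suc i = Letter (w ! i)"
  "tape w ! Suc (length w) = Right_End"
  by (simp_all add: tape_def nth_append)

lemma length_tape: "length (tape w) = Suc (Suc (length w))"
  by (simp add: tape_def)

section \<open>Amplitudes and weights in a round of the automaton\<close>

definition round_amplitude :: "real \<Rightarrow> real \<Rightarrow> real" where
  "round_amplitude b d = 1 / norm (initial_vector b d)"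

lemma round_amplitude_sq: "(round_amplitude b d)\<^sup>2 = 1 / (1 + b\<^sup>2 + d\<^sup>2)"
proof -
  have "(norm (initial_vector b d))\<^sup>2 = 1 + b\<^sup>2 + d\<^sup>2"
    unfolding power2_norm_eq_inner
    by (simp add: initial_vector_def inner_add_left inner_add_right inner_axis_axis power2_eq_square)
  then show ?thesis
    by (simp add: round_amplitude_def power_divide)
qed

lemma round_state_Suc_0:
  "round_state (length_qfa b d) w (Suc 0) = cvec (round_amplitude b d *\<^sub>R initial_vector b d)"
  "outcome_weight (length_qfa b d) w Accepting 0 = 0"
  "outcome_weight (length_qfa b d) w Rejecting 0 = 0"
proof -
  have "round_state (length_qfa b d) w 0 = cvec (unit7 0)"
    by (simp add: cvec_axis length_qfa_def)
  then have *: "trans (length_qfa b d) (tape w ! 0) *v round_state (length_qfa b d) w 0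
      = cvec (round_amplitude b d *\<^sub>R initial_vector b d)"
    by (simp add: tape_nth trans_length_qfa real_trans_Left_End round_amplitude_def sgn_div_norm
        inverse_eq_divide del: round_state.simps real_trans.simps)
  show "round_state (length_qfa b d) w (Suc 0) = cvec (round_amplitude b d *\<^sub>R initial_vector b d)"
    by (subst round_state.simps(2)) (simp add: * project_cvec initial_vector_def
        restrict_kind_simps kind_length_qfa del: round_state.simps)
  show "outcome_weight (length_qfa b d) w Accepting 0 = 0"
    "outcome_weight (length_qfa b d) w Rejecting 0 = 0"
    by (simp_all add: outcome_weight_def * project_cvec initial_vector_def norm_cvec
        restrict_kind_simps kind_length_qfa del: round_state.simps)
qed

lemma real_trans_combination:
  "real_trans b' d' s (c *\<^sub>R (a *\<^sub>R unit7 0 + b *\<^sub>R unit7 1 + d *\<^sub>R unit7 2)) =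
    c *\<^sub>R (a *\<^sub>R real_trans b' d' s (unit7 0) + b *\<^sub>R real_trans b' d' s (unit7 1)
      + d *\<^sub>R real_trans b' d' s (unit7 2))"
  by (simp only: linear_add[OF linear_real_trans] linear_scale[OF linear_real_trans])

text \<open>A letter scales only the amplitude of state 0; the part sent to the restarting state 5
  is projected away. The index is \<open>Suc i\<close> because cell 0 holds the left
  end-marker.\<close>

lemma round_state_letters:
  assumes "i \<le> length w"
  shows "round_state (length_qfa b d) w (Suc i) =
    cvec (round_amplitude b d *\<^sub>R (half_root ^ i *\<^sub>R unit7 0 + b *\<^sub>R unit7 1 + d *\<^sub>R unit7 2))"
  using assms
proof (induction i)
  case 0
  show ?case
    unfolding round_state_Suc_0 by (simp add: initial_vector_def)
next
  case (Suc i)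
  then show ?case
    by (subst round_state.simps(2))
      (simp add: tape_nth trans_length_qfa real_trans_combination real_trans_Letter project_cvec
        restrict_kind_simps kind_length_qfa power_commutes del: round_state.simps real_trans.simps)
qed

lemma outcome_weight_letters:
  assumes "i < length w"
  shows "outcome_weight (length_qfa b d) w Accepting (Suc i) = 0"
    and "outcome_weight (length_qfa b d) w Rejecting (Suc i) = 0"
  using assms
  by (simp_all add: outcome_weight_def tape_nth round_state_letters trans_length_qfa
      real_trans_combination real_trans_Letter project_cvec norm_cvec
      restrict_kind_simps kind_length_qfa del: round_state.simps real_trans.simps)

text \<open>Up to common factors, the restarting state 5 carries the sum and the rejecting state 4
  the difference of \<open>half_root ^ length w\<close> and \<open>b\<close>.\<close>

lemma right_end_state:
  "trans (length_qfa b d) (tape w ! Suc (length w)) *v round_state (length_qfa b d) w (Suc (length w))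
    = cvec (round_amplitude b d *\<^sub>R
       (half_root ^ length w *\<^sub>R half_root *\<^sub>R (unit7 5 + unit7 4)
        + b *\<^sub>R half_root *\<^sub>R (unit7 5 - unit7 4) + d *\<^sub>R unit7 3))"
  by (simp add: tape_nth round_state_letters trans_length_qfa real_trans_combination
      real_trans_Right_End del: round_state.simps real_trans.simps)

lemma outcome_weight_right_end:
  "outcome_weight (length_qfa b d) w Accepting (Suc (length w)) = (round_amplitude b d)\<^sup>2 * d\<^sup>2"
  "outcome_weight (length_qfa b d) w Rejecting (Suc (length w))
    = (round_amplitude b d)\<^sup>2 * (half_root ^ length w - b)\<^sup>2 / 2"
proof -
  show "outcome_weight (length_qfa b d) w Accepting (Suc (length w)) = (round_amplitude b d)\<^sup>2 * d\<^sup>2"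
    unfolding outcome_weight_def right_end_state
    by (simp add: project_cvec norm_cvec restrict_kind_simps kind_length_qfa norm_axis_1 power_mult_distrib)
  have "(half_root ^ length w *\<^sub>R half_root) *\<^sub>R unit7 4 - (b *\<^sub>R half_root) *\<^sub>R unit7 4
      = (half_root * (half_root ^ length w - b)) *\<^sub>R unit7 4"
    by (simp add: algebra_simps)
  then have "outcome_weight (length_qfa b d) w Rejecting (Suc (length w))
      = (norm ((round_amplitude b d * (half_root * (half_root ^ length w - b))) *\<^sub>R unit7 4))\<^sup>2"
    unfolding outcome_weight_def right_end_state project_cvec norm_cvec
    by (simp add: restrict_kind_simps kind_length_qfa algebra_simps del: norm_scaleR)
  also have "\<dots> = (round_amplitude b d * (half_root * (half_root ^ length w - b)))\<^sup>2"
    by (simp only: norm_scaleR norm_axis_1 mult_1_right power2_abs)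
  also have "\<dots> = (round_amplitude b d)\<^sup>2 * (half_root ^ length w - b)\<^sup>2 / 2"
    by (simp add: power_mult_distrib half_root_sq)
  finally show "outcome_weight (length_qfa b d) w Rejecting (Suc (length w))
    = (round_amplitude b d)\<^sup>2 * (half_root ^ length w - b)\<^sup>2 / 2" .
qed

text \<open>After the right end-marker only states 3, 4 and 5 carry amplitude, and none of them is
  nonhalting.\<close>

lemma terminating_rounds_length_qfa: "terminating_rounds (length_qfa b d) w"
proof
  show "round_state (length_qfa b d) w (length (tape w)) = 0"
    unfolding length_tape
    by (subst round_state.simps(2), subst right_end_state)
      (simp add: project_cvec restrict_kind_simps kind_length_qfa cvec_0)
qed (rule unitary_length_qfa)

lemma outcome_tail_length_qfa:
  "outcome_tail (length_qfa b d) w Accepting 0 = (round_amplitude b d)\<^sup>2 * d\<^sup>2"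
  "outcome_tail (length_qfa b d) w Rejecting 0
    = (round_amplitude b d)\<^sup>2 * (half_root ^ length w - b)\<^sup>2 / 2"
proof -
  have "outcome_tail (length_qfa b d) w k 0 = outcome_weight (length_qfa b d) w k 0
      + (\<Sum>i<length w. outcome_weight (length_qfa b d) w k (Suc i))
      + outcome_weight (length_qfa b d) w k (Suc (length w))" for k
    unfolding outcome_tail_def length_tape atLeast0LessThan
    by (subst sum.lessThan_Suc_shift, subst sum.lessThan_Suc) simp
  then show "outcome_tail (length_qfa b d) w Accepting 0 = (round_amplitude b d)\<^sup>2 * d\<^sup>2"
    "outcome_tail (length_qfa b d) w Rejecting 0
      = (round_amplitude b d)\<^sup>2 * (half_root ^ length w - b)\<^sup>2 / 2"
    by (simp_all add: round_state_Suc_0 outcome_weight_letters outcome_weight_right_end)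
qed

lemma is_qfa_restart_length_qfa: "is_qfa_restart \<Sigma> (length_qfa b d)"
  using terminating_rounds.running_in_run[OF terminating_rounds_length_qfa]
  by (auto simp: is_qfa_restart_def unitary_length_qfa) (simp add: length_qfa_def)

section \<open>Separation of lengths and choice of parameters\<close>

lemma half_root_bounds: "0 < half_root" "half_root \<le> 3 / 4"
proof -
  show "half_root \<le> 3 / 4"
    unfolding half_root_def by (rule real_le_lsqrt) (simp_all add: power2_eq_square)
qed (simp add: half_root_def)

text \<open>Since \<open>half_root \<le> 3 / 4\<close>, distinct powers differ by at least a quarter
  of the larger one, hence of either one; squaring gives the factor 1/16.\<close>

lemma half_root_power_diff:
  assumes "n \<noteq> m"
  shows "(half_root ^ m)\<^sup>2 / 16 \<le> (half_root ^ n - half_root ^ m)\<^sup>2"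
proof -
  have anti: "half_root ^ j \<le> half_root ^ i" if "i \<le> j" for i j
    using half_root_bounds that by (intro power_decreasing) auto
  have gap: "half_root ^ j / 4 \<le> half_root ^ i - half_root ^ j" "half_root ^ i / 4 \<le> half_root ^ i - half_root ^ j"
    if "i < j" for i j
  proof -
    have "half_root ^ j \<le> half_root ^ Suc i"
      using that by (intro anti) simp
    also have "\<dots> \<le> 3 / 4 * half_root ^ i"
      using half_root_bounds by (simp add: mult_right_mono)
    finally show "half_root ^ i / 4 \<le> half_root ^ i - half_root ^ j" by simp
    with anti[of i j] that show "half_root ^ j / 4 \<le> half_root ^ i - half_root ^ j" by simp
  qed
  have "\<bar>half_root ^ m / 4\<bar> \<le> \<bar>half_root ^ n - half_root ^ m\<bar>"
    using gap[of n m] gap[of m n] assms half_root_bounds by (cases "n < m") (auto simp: abs_if)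
  then have "(half_root ^ m / 4)\<^sup>2 \<le> (half_root ^ n - half_root ^ m)\<^sup>2"
    by (rule abs_le_square_iff[THEN iffD1])
  then show ?thesis
    by (simp add: power_divide)
qed

theorem theorem19:
  fixes \<Sigma> :: "'a set"
  assumes "finite \<Sigma>"
  shows "\<exists>K>0. \<forall>m>0. \<forall>\<epsilon>>0. \<exists>M :: (7, 'a) qfa_restart.
    is_qfa_restart \<Sigma> M \<and>
    (\<forall>w\<in>words_of_length \<Sigma> m. accept_prob M w = 1) \<and>
    (\<forall>w\<in>lists \<Sigma> - words_of_length \<Sigma> m. reject_prob M w \<ge> 1 - \<epsilon>) \<and>
    (\<forall>w\<in>lists \<Sigma>. expected_runtime M w
       \<le> ennreal (K * (max 1 (1 / \<epsilon>) * 2 ^ m * max 1 (real (length w)))))"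
proof (intro exI[of _ "576 :: real"] conjI allI impI)
  fix m :: nat and \<epsilon> :: real
  assume "\<epsilon> > 0"
  \<comment> \<open>Truncation at 1 keeps \<open>d\<close> bounded for large
    \<open>\<epsilon>\<close> and makes \<open>1 / e\<close> equal to
    \<open>max 1 (1 / \<epsilon>)\<close>.\<close>
  define e where "e = min 1 \<epsilon>"
  have e: "0 < e" "e \<le> 1" "e \<le> \<epsilon>"
    using \<open>\<epsilon> > 0\<close> by (auto simp: e_def)
  define b where "b = half_root ^ m"
  \<comment> \<open>Up to the common factor, the rejecting weight is at least
    \<open>b\<^sup>2 / 32\<close> for lengths other than \<open>m\<close>, so the accepting weight
    \<open>e * b\<^sup>2 / 64\<close> is at most \<open>e\<close> times it.\<close>
  define d where "d = sqrt e / 8 * b"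
  define M :: "(7, 'a) qfa_restart" where "M = length_qfa b d"
  have b2: "b\<^sup>2 = 1 / 2 ^ m"
    by (simp add: b_def power2_eq_square half_root_sq power_one_over flip: power_mult_distrib)
  have b: "0 < b\<^sup>2" "b\<^sup>2 \<le> 1"
    unfolding b2 by simp_all
  have d2: "d\<^sup>2 = e * b\<^sup>2 / 64"
    using e by (simp add: d_def power_mult_distrib power_divide)
  have "d\<^sup>2 \<le> 1"
    using mult_mono[of e 1 "b\<^sup>2" 1] b e by (simp add: d2)
  define N where "N = (round_amplitude b d)\<^sup>2"
  have N: "1 / 3 \<le> N"
    unfolding N_def round_amplitude_sq using b \<open>d\<^sup>2 \<le> 1\<close> by (simp add: field_simps add_pos_nonneg)
  have rounds: "terminating_rounds M w" for w
    unfolding M_def by (rule terminating_rounds_length_qfa)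
  have acc: "outcome_tail M w Accepting 0 = N * d\<^sup>2"
    and rej: "outcome_tail M w Rejecting 0 = N * (half_root ^ length w - b)\<^sup>2 / 2" for w
    by (simp_all add: M_def N_def outcome_tail_length_qfa)
  \<comment> \<open>The accepting weight is the same for all inputs, so it bounds every halting
    weight from below, also for words of length \<open>m\<close>, where the rejecting weight
    vanishes.\<close>
  have acc_pos: "N * d\<^sup>2 > 0"
    using N b e by (simp add: d2)
  have halt: "N * d\<^sup>2 \<le> terminating_rounds.halt_weight M w" for w
    using N by (simp add: terminating_rounds.halt_weight_def[OF rounds] acc rej)
  have halt_pos: "terminating_rounds.halt_weight M w > 0" for w
    using acc_pos halt[of w] by linarith
  have "is_qfa_restart \<Sigma> M"
    unfolding M_def by (rule is_qfa_restart_length_qfa)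
  moreover have "accept_prob M w = 1" if "w \<in> words_of_length \<Sigma> m" for w
  proof -
    have "outcome_tail M w Rejecting 0 = 0"
      using that by (simp add: rej b_def words_of_length_def)
    then show ?thesis
      using halt_pos[of w] terminating_rounds.accept_reject_prob(1)[OF rounds halt_pos, of w]
      by (simp add: terminating_rounds.halt_weight_def[OF rounds])
  qed
  moreover have "reject_prob M w \<ge> 1 - \<epsilon>" if "w \<in> lists \<Sigma> - words_of_length \<Sigma> m" for w
  proof -
    let ?a = "outcome_tail M w Accepting 0" and ?r = "outcome_tail M w Rejecting 0"
    have "length w \<noteq> m"
      using that by (auto simp: words_of_length_def)
    then have "b\<^sup>2 / 16 \<le> (half_root ^ length w - b)\<^sup>2"
      unfolding b_def by (rule half_root_power_diff)
    then have "b\<^sup>2 / 64 \<le> (half_root ^ length w - b)\<^sup>2 / 2"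
      using b by linarith
    then have "d\<^sup>2 \<le> e * ((half_root ^ length w - b)\<^sup>2 / 2)"
      using e mult_left_mono[of "b\<^sup>2 / 64" "(half_root ^ length w - b)\<^sup>2 / 2" e] by (simp add: d2)
    then have "?a \<le> e * ?r"
      using N mult_left_mono[of "d\<^sup>2" "e * ((half_root ^ length w - b)\<^sup>2 / 2)" N]
      by (simp add: acc rej algebra_simps)
    also have "\<dots> \<le> e * (?a + ?r)"
      using e acc_pos by (simp add: acc)
    finally have "(1 - e) * (?a + ?r) \<le> ?r"
      by (simp add: algebra_simps)
    then have "1 - e \<le> ?r / (?a + ?r)"
      using halt_pos[of w] by (simp add: terminating_rounds.halt_weight_def[OF rounds] pos_le_divide_eq)
    then show ?thesis
      using e terminating_rounds.accept_reject_prob(2)[OF rounds halt_pos, of w]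
      by (simp add: terminating_rounds.halt_weight_def[OF rounds])
  qed
  moreover have "expected_runtime M w \<le> ennreal (576 * (max 1 (1 / \<epsilon>) * 2 ^ m * max 1 (real (length w))))" for w
  proof -
    \<comment> \<open>Here \<open>192 = 3 * 64\<close> combines \<open>1 / 3 \<le> N\<close> with
      the 64 in \<open>d\<^sup>2\<close>.\<close>
    have "e * b\<^sup>2 / 192 \<le> N * d\<^sup>2"
      using mult_right_mono[OF N zero_le_power2[of d]] by (simp add: d2)
    then have h: "e * b\<^sup>2 / 192 \<le> terminating_rounds.halt_weight M w"
      using halt[of w] by linarith
    \<comment> \<open>The tape has \<open>length w + 2\<close> cells, at most three times
      \<open>max 1 (length w)\<close>, where the maximum covers the empty word. This gives
      \<open>576 = 3 * 192\<close>.\<close>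
    have "real (length (tape w)) / terminating_rounds.halt_weight M w
        \<le> (3 * max 1 (real (length w))) / (e * b\<^sup>2 / 192)"
      using h e b by (intro frac_le) (auto simp: length_tape)
    also have "\<dots> = 576 * (1 / e * 2 ^ m * max 1 (real (length w)))"
      by (simp add: b2 field_simps)
    also have "1 / e = max 1 (1 / \<epsilon>)"
      using \<open>\<epsilon> > 0\<close> by (auto simp: e_def min_def max_def field_simps)
    finally show ?thesis
      using terminating_rounds.expected_runtime_le[OF rounds halt_pos, of w] ennreal_leI order_trans by blast
  qed
  ultimately show "\<exists>M :: (7, 'a) qfa_restart. is_qfa_restart \<Sigma> M \<and>
    (\<forall>w\<in>words_of_length \<Sigma> m. accept_prob M w = 1) \<and>
    (\<forall>w\<in>lists \<Sigma> - words_of_length \<Sigma> m. reject_prob M w \<ge> 1 - \<epsilon>) \<and>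
    (\<forall>w\<in>lists \<Sigma>. expected_runtime M w
       \<le> ennreal (576 * (max 1 (1 / \<epsilon>) * 2 ^ m * max 1 (real (length w)))))"
    by blast
qed simp

end
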